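(* Let $f\in\mathsf H_1$, let $(x,y)\in D(A)\times D(A^* )$ be the exact solution of the mixed problem $$A^*y+\alpha_1x=f,\qquad \alpha_2Ax=y,$$ and let $(\tilde x,\tilde y)\in D(A)\times D(A^* )$ be arbitrary. Then $$\|(x,y)-(\tilde x,\tilde y)\|^2=\mathcal M(\tilde x,\tilde y),$$ and, if $f\neq0$, also $$\frac{\|(x,y)-(\tilde x,\tilde y)\|^2}{\|(x,y)\|^2}=\frac{\mathcal M(\tilde x,\tilde y)}{|f|_{\mathsf H_1,\alpha_1^{-1}}^2},$$ where $$\mathcal M(\tilde x,\tilde y):=|f-\alpha_1\tilde x-A^*\tilde y|_{\mathsf H_1,\alpha_1^{-1}}^2+|\tilde y-\alpha_2A\tilde x|_{\mathsf H_2,\alpha_2^{-1}}^2 .$$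
   Context: $\mathsf H_1,\mathsf H_2$ are complex Hilbert spaces with inner products $\langle\cdot,\cdot\rangle_{\mathsf H_1}$, $\langle\cdot,\cdot\rangle_{\mathsf H_2}$ (linear in the first argument). $A:D(A)\subset\mathsf H_1\to\mathsf H_2$ is a densely defined, closed linear operator with adjoint $A^*:D(A^* )\subset\mathsf H_2\to\mathsf H_1$. The maps $\alpha_1:\mathsf H_1\to\mathsf H_1$ and $\alpha_2:\mathsf H_2\to\mathsf H_2$ are linear, self-adjoint, positive topological isomorphisms; in particular there is $c>0$ with $c^{-1}|\varphi|^2\le\langle\alpha_j\varphi,\varphi\rangle\le c|\varphi|^2$ for all $\varphi\in\mathsf H_j$, $j=1,2$. Weighted norms: for a self-adjoint positive topological isomorphism $\beta$ of $\mathsf H_j$, $|\varphi|_{\mathsf H_j,\beta}^2:=\langle\beta\varphi,\varphi\rangle_{\mathsf H_j}$. For $(\varphi,\psi)\in D(A)\times D(A^* )$ the combined norm is $$\|(\varphi,\psi)\|^2:=|\varphi|_{\mathsf H_1,\alpha_1}^2+|A\varphi|_{\mathsf H_2,\alpha_2}^2+|\psi|_{\mathsf H_2,\alpha_2^{-1}}^2+|A^*\psi|_{\mathsf H_1,\alpha_1^{-1}}^2 .$$ The mixed problem has a unique solution $(x,y)\in D(A)\times D(A^* )$ for each $f\in\mathsf H_1$. *)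

theory Defs
  imports "HOL-Analysis.Analysis"
begin

section \<open>Complex Hilbert spaces\<close>

text \<open>
  The libraries imported here only provide real inner product spaces. A complex inner product is
  added on top of \<^class>\<open>real_normed_vector\<close>, so that norm, topology and completeness are those of
  the library. Following the source, it is linear in its \<^emph>\<open>first\<close> argument. Positive definiteness is
  contained in the axiom \<open>cinner_self\<close>.
\<close>

class complex_inner = real_normed_vector +
  fixes scaleC :: "complex \<Rightarrow> 'a \<Rightarrow> 'a"  (infixr \<open>*\<^sub>C\<close> 75)
    and cinner :: "'a \<Rightarrow> 'a \<Rightarrow> complex"
  assumes scaleC_add_right: "a *\<^sub>C (x + y) = a *\<^sub>C x + a *\<^sub>C y"
    and scaleC_add_left: "(a + b) *\<^sub>C x = a *\<^sub>C x + b *\<^sub>C x"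
    and scaleC_scaleC: "a *\<^sub>C (b *\<^sub>C x) = (a * b) *\<^sub>C x"
    and scaleC_of_real: "complex_of_real r *\<^sub>C x = r *\<^sub>R x"
    and cinner_commute: "cinner x y = cnj (cinner y x)"
    and cinner_add_left: "cinner (x + y) z = cinner x z + cinner y z"
    and cinner_scaleC_left: "cinner (a *\<^sub>C x) y = a * cinner x y"
    and cinner_self: "cinner x x = complex_of_real ((norm x)\<^sup>2)"

class complex_hilbert_space = complex_inner + complete_space

global_interpretation complex_vector: vector_space "scaleC :: complex \<Rightarrow> 'a \<Rightarrow> 'a::complex_inner"
proof
  show "1 *\<^sub>C x = x" for x :: 'a
    using scaleC_of_real[of 1 x] by simp
qed (simp_all add: scaleC_add_right scaleC_add_left scaleC_scaleC)

instantiation complex :: complex_hilbert_space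
begin

definition "scaleC_complex (a :: complex) (x :: complex) = a * x"
definition "cinner_complex (x :: complex) (y :: complex) = x * cnj y"

instance
  by standard
    (simp_all add: scaleC_complex_def cinner_complex_def algebra_simps scaleR_conv_of_real
       flip: complex_norm_square)

end

lemma cinner_add_right: "cinner x (y + z) = cinner x y + cinner x z"
  by (metis cinner_add_left cinner_commute complex_cnj_add)

lemma cinner_scaleC_right: "cinner x (a *\<^sub>C y) = cnj a * cinner x y"
  by (metis cinner_commute cinner_scaleC_left complex_cnj_mult)


section \<open>Unbounded operators and their adjoints\<close>

text \<open>
  An unbounded operator is given by its domain \<open>D\<close> together with a function \<open>A\<close> whose values
  outside \<open>D\<close> are irrelevant.
\<close>

definition linear_op_on :: "'a::complex_inner set \<Rightarrow> ('a \<Rightarrow> 'b::complex_inner) \<Rightarrow> bool" where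
  "linear_op_on D A \<longleftrightarrow>
     complex_vector.subspace D \<and>
     (\<forall>x\<in>D. \<forall>y\<in>D. A (x + y) = A x + A y) \<and>
     (\<forall>c. \<forall>x\<in>D. A (c *\<^sub>C x) = c *\<^sub>C A x)"

definition densely_defined_closed_op ::
    "'a::complex_inner set \<Rightarrow> ('a \<Rightarrow> 'b::complex_inner) \<Rightarrow> bool" where
  "densely_defined_closed_op D A \<longleftrightarrow>
     linear_op_on D A \<and> closure D = UNIV \<and> closed ((\<lambda>x. (x, A x)) ` D)"

definition adj_dom :: "'a::complex_inner set \<Rightarrow> ('a \<Rightarrow> 'b::complex_inner) \<Rightarrow> 'b set" where
  "adj_dom D A = {y. \<exists>z. \<forall>x\<in>D. cinner (A x) y = cinner x z}"

text \<open>The description is unique when \<open>D\<close> is dense (lemma \<open>adj_op_unique\<close> below).\<close>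

definition adj_op :: "'a::complex_inner set \<Rightarrow> ('a \<Rightarrow> 'b::complex_inner) \<Rightarrow> 'b \<Rightarrow> 'a" where
  "adj_op D A y = (THE z. \<forall>x\<in>D. cinner (A x) y = cinner x z)"


section \<open>Weights and weighted norms\<close>

definition pos_top_iso :: "('a::complex_inner \<Rightarrow> 'a) \<Rightarrow> bool" where
  "pos_top_iso \<beta> \<longleftrightarrow>
     Vector_Spaces.linear scaleC scaleC \<beta> \<and>
     homeomorphism UNIV UNIV \<beta> (inv \<beta>) \<and>
     (\<forall>x y. cinner (\<beta> x) y = cinner x (\<beta> y)) \<and>
     (\<forall>x. 0 \<le> Re (cinner (\<beta> x) x))"

text \<open>
  For self-adjoint \<open>\<beta>\<close> the value \<open>cinner (\<beta> x) x\<close> is real, see lemma \<open>wnorm_square\<close> below.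
\<close>

definition wnorm :: "('a::complex_inner \<Rightarrow> 'a) \<Rightarrow> 'a \<Rightarrow> real" where
  "wnorm \<beta> x = sqrt (Re (cinner (\<beta> x) x))"

definition combined_norm ::
    "'a::complex_inner set \<Rightarrow> ('a \<Rightarrow> 'b::complex_inner) \<Rightarrow> ('a \<Rightarrow> 'a) \<Rightarrow> ('b \<Rightarrow> 'b) \<Rightarrow> 'a \<times> 'b \<Rightarrow> real"
  where
  "combined_norm D A \<alpha>1 \<alpha>2 = (\<lambda>(\<phi>, \<psi>).
     sqrt ((wnorm \<alpha>1 \<phi>)\<^sup>2 + (wnorm \<alpha>2 (A \<phi>))\<^sup>2 +
           (wnorm (inv \<alpha>2) \<psi>)\<^sup>2 + (wnorm (inv \<alpha>1) (adj_op D A \<psi>))\<^sup>2))"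


section \<open>The mixed problem and its error functional\<close>

definition mixed_solution ::
    "'a::complex_inner set \<Rightarrow> ('a \<Rightarrow> 'b::complex_inner) \<Rightarrow> ('a \<Rightarrow> 'a) \<Rightarrow> ('b \<Rightarrow> 'b) \<Rightarrow> 'a \<Rightarrow> 'a \<Rightarrow> 'b \<Rightarrow> bool"
  where
  "mixed_solution D A \<alpha>1 \<alpha>2 f x y \<longleftrightarrow>
     x \<in> D \<and> y \<in> adj_dom D A \<and> adj_op D A y + \<alpha>1 x = f \<and> \<alpha>2 (A x) = y"

definition error_functional ::
    "'a::complex_inner set \<Rightarrow> ('a \<Rightarrow> 'b::complex_inner) \<Rightarrow> ('a \<Rightarrow> 'a) \<Rightarrow> ('b \<Rightarrow> 'b) \<Rightarrow> 'a \<Rightarrow> 'a \<Rightarrow> 'b \<Rightarrow> real"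
  where
  "error_functional D A \<alpha>1 \<alpha>2 f x' y' =
     (wnorm (inv \<alpha>1) (f - \<alpha>1 x' - adj_op D A y'))\<^sup>2 + (wnorm (inv \<alpha>2) (y' - \<alpha>2 (A x')))\<^sup>2"


section \<open>Basic properties\<close>

lemma cinner_zero_left [simp]: "cinner 0 y = 0"
  using cinner_add_left[of 0 0 y] by simp

lemma cinner_minus_left: "cinner (- x) y = - cinner x y"
  using cinner_add_left[of x "- x" y] by (simp add: eq_neg_iff_add_eq_0 add.commute)

lemma cinner_diff_left: "cinner (x - y) z = cinner x z - cinner y z"
  using cinner_add_left[of x "- y" z] by (simp add: cinner_minus_left)

lemma cinner_zero_right [simp]: "cinner x 0 = 0"
  using cinner_add_right[of x 0 0] by simp

lemma cinner_minus_right: "cinner x (- y) = - cinner x y"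
  using cinner_add_right[of x y "- y"] by (simp add: eq_neg_iff_add_eq_0 add.commute)

lemma cinner_diff_right: "cinner x (y - z) = cinner x y - cinner x z"
  using cinner_add_right[of x y "- z"] by (simp add: cinner_minus_right)

lemma pos_top_iso_id: "pos_top_iso (\<lambda>x::'a::complex_inner. x)"
proof -
  have "Vector_Spaces.linear scaleC scaleC (\<lambda>x::'a. x)"
    by (rule complex_vector.linear_ident)
  moreover have "inv (\<lambda>x::'a. x) = (\<lambda>x. x)"
    using inv_id by (simp add: id_def)
  ultimately show ?thesis
    by (auto simp: pos_top_iso_def homeomorphism_def cinner_self)
qed

lemma
  assumes "pos_top_iso \<beta>"
  shows pos_top_iso_add: "\<beta> (x + y) = \<beta> x + \<beta> y"
    and pos_top_iso_scaleC: "\<beta> (c *\<^sub>C x) = c *\<^sub>C \<beta> x"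
    and pos_top_iso_inv [simp]: "\<beta> (inv \<beta> x) = x" "inv \<beta> (\<beta> x) = x"
  using assms
  by (auto simp: pos_top_iso_def homeomorphism_def Vector_Spaces.linear_def module_hom_def
        module_hom_axioms_def)

lemma pos_top_iso_selfadjoint: "pos_top_iso \<beta> \<Longrightarrow> cinner (\<beta> x) y = cinner x (\<beta> y)"
  by (simp add: pos_top_iso_def)

lemma pos_top_iso_nonneg: "pos_top_iso \<beta> \<Longrightarrow> 0 \<le> Re (cinner (\<beta> x) x)"
  unfolding pos_top_iso_def by blast

lemma pos_top_iso_scaleR: "pos_top_iso \<beta> \<Longrightarrow> \<beta> (r *\<^sub>R x) = r *\<^sub>R \<beta> x"
  by (metis pos_top_iso_scaleC scaleC_of_real)

lemma pos_top_iso_bounded_linear: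
  assumes "pos_top_iso \<beta>"
  shows "bounded_linear \<beta>"
proof -
  have zero: "\<beta> 0 = 0"
    using pos_top_iso_scaleR[OF assms, of 0 0] by simp
  have "continuous (at 0) \<beta>"
    using assms unfolding pos_top_iso_def homeomorphism_def
    by (metis UNIV_I continuous_on_eq_continuous_at open_UNIV)
  then obtain d where d: "d > 0" "\<And>x. norm x < d \<Longrightarrow> norm (\<beta> x) < 1"
    using zero unfolding continuous_at_eps_delta by (auto elim!: allE[of _ "1::real"])
  show ?thesis
  proof (rule bounded_linear_intro[where K = "2 / d"])
    show "norm (\<beta> x) \<le> norm x * (2 / d)" for x
    proof (cases "x = 0")
      case False
      define t where "t = d / (2 * norm x)"
      have t: "t > 0" "norm (t *\<^sub>R x) < d"
        using d(1) False by (auto simp: t_def)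
      have "t * norm (\<beta> x) < 1"
        using d(2)[OF t(2)] t(1) by (simp add: pos_top_iso_scaleR[OF assms])
      then show ?thesis
        using d(1) False by (simp add: t_def field_simps)
    qed (simp add: zero)
  qed (simp_all add: assms pos_top_iso_add pos_top_iso_scaleR)
qed

lemma pos_top_iso_inverse:
  assumes "pos_top_iso \<beta>"
  shows "pos_top_iso (inv \<beta>)"
proof -
  note r = pos_top_iso_inv[OF assms]
  have add: "inv \<beta> (x + y) = inv \<beta> x + inv \<beta> y" for x y
    by (metis assms pos_top_iso_add r)
  have scale: "inv \<beta> (c *\<^sub>C x) = c *\<^sub>C inv \<beta> x" for c x
    by (metis assms pos_top_iso_scaleC r)
  have "Vector_Spaces.linear scaleC scaleC (inv \<beta>)"
    by (simp add: Vector_Spaces.linear_def module_hom_def module_hom_axioms_def add scale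
        complex_vector.vector_space_axioms complex_vector.module_axioms)
  moreover have "inv (inv \<beta>) = \<beta>"
    by (metis bijI' inv_inv_eq r)
  moreover have "homeomorphism UNIV UNIV (inv \<beta>) \<beta>"
    using assms homeomorphism_sym by (auto simp: pos_top_iso_def)
  moreover have sa: "cinner (inv \<beta> x) y = cinner x (inv \<beta> y)" for x y
    by (metis assms pos_top_iso_selfadjoint r(1))
  moreover have "0 \<le> Re (cinner (inv \<beta> x) x)" for x
    by (metis assms pos_top_iso_def r(1) sa)
  ultimately show ?thesis
    by (simp add: pos_top_iso_def)
qed

lemma wnorm_square:
  assumes "pos_top_iso \<beta>"
  shows "complex_of_real ((wnorm \<beta> x)\<^sup>2) = cinner (\<beta> x) x"
proof -
  have "cnj (cinner (\<beta> x) x) = cinner (\<beta> x) x"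
    using assms cinner_commute pos_top_iso_selfadjoint by metis
  then have "Im (cinner (\<beta> x) x) = 0"
    by (simp add: complex_eq_iff)
  moreover have "0 \<le> Re (cinner (\<beta> x) x)"
    using pos_top_iso_nonneg[OF assms] .
  ultimately show ?thesis
    by (simp add: wnorm_def complex_eq_iff)
qed

lemma pos_top_iso_Cauchy_Schwarz:
  assumes "pos_top_iso \<beta>"
  shows "(Re (cinner (\<beta> x) y))\<^sup>2 \<le> Re (cinner (\<beta> x) x) * Re (cinner (\<beta> y) y)"
proof -
  define a b c where "a = Re (cinner (\<beta> y) y)" and "b = Re (cinner (\<beta> x) y)"
    and "c = Re (cinner (\<beta> x) x)"
  have sym: "Re (cinner (\<beta> y) x) = b"
    using pos_top_iso_selfadjoint[OF assms, of x y] cinner_commute[of x "\<beta> y"]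
    by (simp add: b_def)
  have "cinner (\<beta> (x + complex_of_real t *\<^sub>C y)) (x + complex_of_real t *\<^sub>C y) =
      cinner (\<beta> x) x + t * cinner (\<beta> x) y + t * cinner (\<beta> y) x + t * (t * cinner (\<beta> y) y)" for t
    by (simp add: assms pos_top_iso_add pos_top_iso_scaleC cinner_add_left cinner_add_right
        cinner_scaleC_left cinner_scaleC_right distrib_left add.assoc)
  then have "Re (cinner (\<beta> (x + complex_of_real t *\<^sub>C y)) (x + complex_of_real t *\<^sub>C y)) =
      c + 2 * t * b + t\<^sup>2 * a" for t
    using sym by (simp add: a_def b_def c_def power2_eq_square algebra_simps)
  then have nonneg: "0 \<le> c + 2 * t * b + t\<^sup>2 * a" for t
    using pos_top_iso_nonneg[OF assms, of "x + complex_of_real t *\<^sub>C y"] by simp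
  have a: "a \<ge> 0"
    using pos_top_iso_nonneg[OF assms] by (simp add: a_def)
  have "b\<^sup>2 \<le> c * a"
  proof (cases "a = 0")
    case True
    have "b = 0"
    proof (rule ccontr)
      assume "b \<noteq> 0"
      then show False
        using nonneg[of "- (c + 1) / (2 * b)"] True by (simp add: field_simps)
    qed
    then show ?thesis
      using True by simp
  next
    case False
    then have "0 \<le> a * (c + 2 * (- b / a) * b + (- b / a)\<^sup>2 * a)"
      using nonneg[of "- b / a"] a by simp
    also have "\<dots> = c * a - b\<^sup>2"
      using False by (simp add: field_simps power2_eq_square)
    finally show ?thesis by simp
  qed
  then show ?thesis
    by (simp add: a_def b_def c_def)
qed

lemma Re_cinner_bound: "\<bar>Re (cinner x y)\<bar> \<le> norm x * norm y"
proof -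
  have "(Re (cinner x y))\<^sup>2 \<le> (norm x * norm y)\<^sup>2"
    using pos_top_iso_Cauchy_Schwarz[OF pos_top_iso_id, of x y]
    by (simp add: cinner_self power_mult_distrib flip: of_real_power)
  then show ?thesis
    using abs_le_square_iff[of "Re (cinner x y)" "norm x * norm y"] by simp
qed

text \<open>Positivity of a topological isomorphism is automatically uniform.\<close>

lemma pos_top_iso_coercive:
  assumes "pos_top_iso \<beta>"
  shows "\<exists>c>0. \<forall>x. (norm x)\<^sup>2 / c \<le> Re (cinner (\<beta> x) x) \<and> Re (cinner (\<beta> x) x) \<le> c * (norm x)\<^sup>2"
proof -
  obtain K where K: "K > 0" "\<And>x. norm (\<beta> x) \<le> norm x * K"
    using bounded_linear.pos_bounded[OF pos_top_iso_bounded_linear[OF assms]] by blast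
  obtain L where L: "L > 0" "\<And>x. norm (inv \<beta> x) \<le> norm x * L"
    using bounded_linear.pos_bounded[OF pos_top_iso_bounded_linear[OF pos_top_iso_inverse[OF assms]]]
    by blast
  have upper: "Re (cinner (\<beta> x) x) \<le> K * (norm x)\<^sup>2" for x
  proof -
    have "Re (cinner (\<beta> x) x) \<le> norm (\<beta> x) * norm x"
      using Re_cinner_bound[of "\<beta> x" x] by simp
    also have "\<dots> \<le> norm x * K * norm x"
      using K(2) by (intro mult_right_mono) auto
    finally show ?thesis by (simp add: power2_eq_square algebra_simps)
  qed
  have lower: "(norm x)\<^sup>2 \<le> L\<^sup>2 * K * Re (cinner (\<beta> x) x)" for x
  proof -
    define q where "q = Re (cinner (\<beta> x) x)"
    have q: "q \<ge> 0"
      using pos_top_iso_nonneg[OF assms] by (simp add: q_def)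
    have "((norm (\<beta> x))\<^sup>2)\<^sup>2 \<le> q * Re (cinner (\<beta> (\<beta> x)) (\<beta> x))"
      using pos_top_iso_Cauchy_Schwarz[OF assms, of x "\<beta> x"]
      by (simp add: q_def cinner_self flip: of_real_power)
    also have "\<dots> \<le> q * (K * (norm (\<beta> x))\<^sup>2)"
      using upper q by (intro mult_left_mono) auto
    finally have "(norm (\<beta> x))\<^sup>2 * (norm (\<beta> x))\<^sup>2 \<le> (K * q) * (norm (\<beta> x))\<^sup>2"
      by (simp add: power2_eq_square algebra_simps)
    then have *: "(norm (\<beta> x))\<^sup>2 \<le> K * q"
      using q K(1) mult_right_le_imp_le[of "(norm (\<beta> x))\<^sup>2" "(norm (\<beta> x))\<^sup>2" "K * q"]
      by (cases "norm (\<beta> x) = 0") (simp_all del: zero_less_power2 add: zero_less_power)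
    have "norm x \<le> norm (\<beta> x) * L"
      using L(2)[of "\<beta> x"] by (simp add: assms)
    then have "(norm x)\<^sup>2 \<le> (norm (\<beta> x) * L)\<^sup>2"
      by (intro power_mono) auto
    also have "\<dots> \<le> L\<^sup>2 * (K * q)"
      using mult_left_mono[OF *, of "L\<^sup>2"] by (simp add: power_mult_distrib mult_ac)
    finally show ?thesis by (simp add: q_def mult.assoc)
  qed
  define c where "c = max K (L\<^sup>2 * K)"
  have c: "c > 0" "K \<le> c" "L\<^sup>2 * K \<le> c"
    using K(1) by (auto simp: c_def)
  have "(norm x)\<^sup>2 / c \<le> Re (cinner (\<beta> x) x) \<and> Re (cinner (\<beta> x) x) \<le> c * (norm x)\<^sup>2" for x
  proof
    have "0 \<le> Re (cinner (\<beta> x) x)"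
      using pos_top_iso_nonneg[OF assms] .
    then have "(norm x)\<^sup>2 \<le> c * Re (cinner (\<beta> x) x)"
      using order_trans[OF lower[of x] mult_right_mono[OF c(3)]] by blast
    then show "(norm x)\<^sup>2 / c \<le> Re (cinner (\<beta> x) x)"
      using c(1) by (simp add: field_simps)
    show "Re (cinner (\<beta> x) x) \<le> c * (norm x)\<^sup>2"
      using order_trans[OF upper[of x] mult_right_mono[OF c(2)]] by simp
  qed
  then show ?thesis
    using c(1) by blast
qed

lemma wnorm_eq_0_iff:
  assumes "pos_top_iso \<beta>"
  shows "wnorm \<beta> x = 0 \<longleftrightarrow> x = 0"
proof
  assume "wnorm \<beta> x = 0"
  then have "Re (cinner (\<beta> x) x) = 0"
    by (simp add: wnorm_def)
  moreover obtain c where "c > 0" "(norm x)\<^sup>2 / c \<le> Re (cinner (\<beta> x) x)"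
    using pos_top_iso_coercive[OF assms] by blast
  ultimately show "x = 0"
    by (simp add: divide_le_0_iff)
qed (simp add: wnorm_def)

lemma combined_norm_eq_0D:
  assumes "pos_top_iso \<alpha>1" "pos_top_iso \<alpha>2" "combined_norm D A \<alpha>1 \<alpha>2 (\<phi>, \<psi>) = 0"
  shows "\<phi> = 0" "\<psi> = 0"
proof -
  have "(wnorm \<alpha>1 \<phi>)\<^sup>2 + (wnorm \<alpha>2 (A \<phi>))\<^sup>2 +
      (wnorm (inv \<alpha>2) \<psi>)\<^sup>2 + (wnorm (inv \<alpha>1) (adj_op D A \<psi>))\<^sup>2 = 0"
    using assms(3) by (simp add: combined_norm_def)
  then have "wnorm \<alpha>1 \<phi> = 0" "wnorm (inv \<alpha>2) \<psi> = 0"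
    by (simp_all add: add_nonneg_eq_0_iff)
  then show "\<phi> = 0" "\<psi> = 0"
    using assms(1) pos_top_iso_inverse[OF assms(2)] by (simp_all add: wnorm_eq_0_iff)
qed

lemma adj_op_unique:
  assumes "closure D = UNIV" "\<forall>x\<in>D. cinner (A x) y = cinner x z"
  shows "adj_op D A y = z"
  unfolding adj_op_def
proof (rule the_equality)
  fix z' assume z': "\<forall>x\<in>D. cinner (A x) y = cinner x z'"
  define w where "w = z' - z"
  have "bounded_linear (\<lambda>x. Re (cinner x w))"
  proof (rule bounded_linear_intro)
    show "Re (cinner (r *\<^sub>R x) w) = r *\<^sub>R Re (cinner x w)" for r x
      using cinner_scaleC_left[of "complex_of_real r" x w] by (simp add: scaleC_of_real)
    show "norm (Re (cinner x w)) \<le> norm x * norm w" for x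
      using Re_cinner_bound by simp
  qed (simp add: cinner_add_left)
  then have "closed {x. Re (cinner x w) = 0}"
    by (intro closed_Collect_eq linear_continuous_on continuous_on_const)
  moreover have "D \<subseteq> {x. Re (cinner x w) = 0}"
    using assms(2) z' by (auto simp: w_def cinner_diff_right)
  ultimately have "Re (cinner w w) = 0"
    using closure_minimal[of D] assms(1) by blast
  then show "z' = z"
    by (simp add: w_def cinner_self flip: of_real_power)
qed (use assms(2) in simp)

end

theory Submission
  imports Defs
begin

text \<open>
  The combined norm is the pullback of the weighted norm of the residual: for
  \<open>\<phi> \<in> D(A)\<close> and \<open>\<psi> \<in> D(A\<^sup>*)\<close>,
  \<open>\<parallel>(\<phi>, \<psi>)\<parallel>\<^sup>2 = |\<alpha>1 \<phi> + A\<^sup>*\<psi>|\<^sup>2 + |\<psi> - \<alpha>2 A\<phi>|\<^sup>2\<close>, where the two terms on the right carry the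
  weights \<open>\<alpha>1\<^sup>-\<^sup>1\<close> and \<open>\<alpha>2\<^sup>-\<^sup>1\<close>.
  Indeed, expanding the two squares on the right yields the four terms on the left, together with the
  cross terms \<open>2 Re \<langle>\<phi>, A\<^sup>*\<psi>\<rangle>\<close> and \<open>- 2 Re \<langle>A\<phi>, \<psi>\<rangle>\<close>, and these cancel because \<open>A\<^sup>*\<close> is the adjoint
  of \<open>A\<close>. This identity is \<open>combined_norm_square_eq_residual\<close>; the expansion of one square is
  \<open>wnorm_inv_add_square\<close>.

  Applied to the error \<open>(x - x', y - y')\<close>, the identity gives the first claim, since the residual of
  the error is, up to a sign in the second component, the residual of \<open>(x', y')\<close> in the mixed
  problem. Applied to \<open>(x, y)\<close> itself, it gives \<open>\<parallel>(x, y)\<parallel>\<^sup>2 = |f|\<^sup>2\<close> in the weight \<open>\<alpha>1\<^sup>-\<^sup>1\<close>, hence the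
  second claim.
\<close>

lemma adj_op_cinner:
  assumes "closure D = UNIV" "y \<in> adj_dom D A" "x \<in> D"
  shows "cinner (A x) y = cinner x (adj_op D A y)"
proof -
  obtain z where z: "\<forall>x\<in>D. cinner (A x) y = cinner x z"
    using assms(2) by (auto simp: adj_dom_def)
  then show ?thesis
    using adj_op_unique[OF assms(1) z] assms(3) by simp
qed

lemma
  assumes "closure D = UNIV" "y \<in> adj_dom D A" "y' \<in> adj_dom D A"
  shows adj_dom_diff: "y - y' \<in> adj_dom D A"
    and adj_op_diff: "adj_op D A (y - y') = adj_op D A y - adj_op D A y'"
proof -
  have adj: "\<forall>x\<in>D. cinner (A x) (y - y') = cinner x (adj_op D A y - adj_op D A y')"
    using assms by (simp add: cinner_diff_right adj_op_cinner)
  then show "y - y' \<in> adj_dom D A"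
    by (auto simp: adj_dom_def)
  show "adj_op D A (y - y') = adj_op D A y - adj_op D A y'"
    using adj_op_unique[OF assms(1) adj] .
qed

lemma
  assumes "linear_op_on D A" "x \<in> D" "x' \<in> D"
  shows linear_op_on_diff_mem: "x - x' \<in> D"
    and linear_op_on_diff: "A (x - x') = A x - A x'"
proof -
  show diff: "x - x' \<in> D"
    using assms complex_vector.subspace_diff by (auto simp: linear_op_on_def)
  have "A ((x - x') + x') = A (x - x') + A x'"
    using assms diff unfolding linear_op_on_def by blast
  then show "A (x - x') = A x - A x'"
    by simp
qed

lemma pos_top_iso_minus: "pos_top_iso \<beta> \<Longrightarrow> \<beta> (- x) = - \<beta> x"
  using pos_top_iso_scaleR[of \<beta> "-1" x] by simp

lemma pos_top_iso_diff: "pos_top_iso \<beta> \<Longrightarrow> \<beta> (x - y) = \<beta> x - \<beta> y"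
  using pos_top_iso_add[of \<beta> x "- y"] by (simp add: pos_top_iso_minus)

lemma wnorm_minus: "pos_top_iso \<beta> \<Longrightarrow> wnorm \<beta> (- x) = wnorm \<beta> x"
  by (simp add: wnorm_def pos_top_iso_minus cinner_minus_left cinner_minus_right)

lemma wnorm_square_Re: "pos_top_iso \<beta> \<Longrightarrow> (wnorm \<beta> x)\<^sup>2 = Re (cinner (\<beta> x) x)"
  by (simp add: wnorm_def pos_top_iso_nonneg)

text \<open>
  A weight \<open>\<beta>\<close> is an isometry from the \<open>\<beta>\<close>-norm to the \<open>\<beta>\<^sup>-\<^sup>1\<close>-norm, and it turns the cross term of
  the square into the unweighted inner product.
\<close>

lemma wnorm_inv_add_square:
  assumes "pos_top_iso \<beta>"
  shows "(wnorm (inv \<beta>) (\<beta> u + v))\<^sup>2 = (wnorm \<beta> u)\<^sup>2 + (wnorm (inv \<beta>) v)\<^sup>2 + 2 * Re (cinner u v)"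
proof -
  note inv = pos_top_iso_inverse[OF assms]
  have "cinner (inv \<beta> v) (\<beta> u) = cinner v u"
    using pos_top_iso_selfadjoint[OF inv] assms by simp
  moreover have "cinner u (\<beta> u) = cinner (\<beta> u) u"
    using pos_top_iso_selfadjoint[OF assms] by simp
  moreover have "Re (cinner v u) = Re (cinner u v)"
    by (subst cinner_commute) simp
  ultimately show ?thesis
    by (simp add: wnorm_square_Re assms inv pos_top_iso_add[OF inv] cinner_add_left cinner_add_right)
qed

lemma combined_norm_square_eq_residual:
  assumes "closure D = UNIV" "pos_top_iso \<alpha>1" "pos_top_iso \<alpha>2"
    and "\<phi> \<in> D" "\<psi> \<in> adj_dom D A"
  shows "(combined_norm D A \<alpha>1 \<alpha>2 (\<phi>, \<psi>))\<^sup>2 =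
    (wnorm (inv \<alpha>1) (\<alpha>1 \<phi> + adj_op D A \<psi>))\<^sup>2 + (wnorm (inv \<alpha>2) (\<psi> - \<alpha>2 (A \<phi>)))\<^sup>2"
proof -
  have "(wnorm (inv \<alpha>2) (\<psi> - \<alpha>2 (A \<phi>)))\<^sup>2 =
      (wnorm \<alpha>2 (A \<phi>))\<^sup>2 + (wnorm (inv \<alpha>2) \<psi>)\<^sup>2 - 2 * Re (cinner (A \<phi>) \<psi>)"
    using wnorm_inv_add_square[OF assms(3), of "- A \<phi>" \<psi>] assms(3)
    by (simp add: pos_top_iso_minus wnorm_minus cinner_minus_left)
  moreover have "cinner (A \<phi>) \<psi> = cinner \<phi> (adj_op D A \<psi>)"
    using adj_op_cinner[OF assms(1,5,4)] .
  ultimately show ?thesis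
    by (simp add: combined_norm_def wnorm_inv_add_square[OF assms(2)])
qed

theorem theorem2p5:
  fixes D :: "'a::complex_hilbert_space set"
    and A :: "'a \<Rightarrow> 'b::complex_hilbert_space"
    and \<alpha>1 :: "'a \<Rightarrow> 'a" and \<alpha>2 :: "'b \<Rightarrow> 'b"
    and f x x' :: 'a and y y' :: 'b
  assumes "densely_defined_closed_op D A"
    and "pos_top_iso \<alpha>1" and "pos_top_iso \<alpha>2"
    and "mixed_solution D A \<alpha>1 \<alpha>2 f x y"
    and "x' \<in> D" and "y' \<in> adj_dom D A"
  shows "(combined_norm D A \<alpha>1 \<alpha>2 ((x, y) - (x', y')))\<^sup>2 = error_functional D A \<alpha>1 \<alpha>2 f x' y' \<and>
    (f \<noteq> 0 \<longrightarrow>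
      (combined_norm D A \<alpha>1 \<alpha>2 ((x, y) - (x', y')))\<^sup>2 / (combined_norm D A \<alpha>1 \<alpha>2 (x, y))\<^sup>2 =
      error_functional D A \<alpha>1 \<alpha>2 f x' y' / (wnorm (inv \<alpha>1) f)\<^sup>2)"
proof -
  have lin: "linear_op_on D A" and dense: "closure D = UNIV"
    using assms(1) by (auto simp: densely_defined_closed_op_def)
  have x: "x \<in> D" and y: "y \<in> adj_dom D A" and f: "adj_op D A y + \<alpha>1 x = f" and Ax: "\<alpha>2 (A x) = y"
    using assms(4) by (auto simp: mixed_solution_def)
  have res1: "\<alpha>1 (x - x') + adj_op D A (y - y') = f - \<alpha>1 x' - adj_op D A y'"
    using f by (simp add: pos_top_iso_diff[OF assms(2)] adj_op_diff[OF dense y assms(6)] algebra_simps)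
  have res2: "(y - y') - \<alpha>2 (A (x - x')) = - (y' - \<alpha>2 (A x'))"
    by (simp add: linear_op_on_diff[OF lin x assms(5)] pos_top_iso_diff[OF assms(3)] Ax)
  have error: "(combined_norm D A \<alpha>1 \<alpha>2 ((x, y) - (x', y')))\<^sup>2 = error_functional D A \<alpha>1 \<alpha>2 f x' y'"
    using combined_norm_square_eq_residual[OF dense assms(2,3)
        linear_op_on_diff_mem[OF lin x assms(5)] adj_dom_diff[OF dense y assms(6)]]
    unfolding res1 res2
    by (simp add: error_functional_def wnorm_minus[OF pos_top_iso_inverse[OF assms(3)]]
        del: minus_diff_eq)
  have "wnorm (inv \<alpha>2) 0 = 0"
    by (simp add: wnorm_def)
  then have "(combined_norm D A \<alpha>1 \<alpha>2 (x, y))\<^sup>2 = (wnorm (inv \<alpha>1) f)\<^sup>2"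
    using combined_norm_square_eq_residual[OF dense assms(2,3) x y] f Ax by (simp add: add.commute)
  with error show ?thesis
    by simp
qed

end
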